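(* Fix positive integers $m$ and $n$ with $n\ge 64m$. Let $\mathrm c=(c_0,\dots,c_n)$ be a $1$-free child sequence with $c_0=0$ and with $\mathcal T_{\mathrm c}$ nonempty, and let $\mathbf h=\operatorname{ht}_{\mathbf T}(0)$, where $(\mathbf T,\mathbf P)$ is uniformly random in $\{(T,P):T\in\mathcal T_{\mathrm c},\,P\in\mathcal P_{m,\operatorname{ht}_T(0)}\}$. Then for all $x\ge0$, $$\mathbb P\left\{\mathbf h\ge 2\sqrt{mn}+x\sqrt n\right\}\le\exp\left(-\frac{x^2}{3}+4\right).$$
   Context: A child sequence is a finite sequence $\mathrm c=(c_v,v\in V)$ of nonnegative integers with $\sum_{v\in V}c_v\le|V|-1$; here $(c_0,\dots,c_n)$ is indexed by $V=\{0,1,\dots,n\}$. It is $1$-free if no entry equals $1$. $\mathcal T_{\mathrm c}$ is the set of rooted (labeled) trees with vertex set $V$ in which each $v\in V$ has exactly $c_v$ children (nonempty only if $\sum_v c_v=|V|-1$). $\operatorname{ht}_T(v)$ is the graph distance from the root of $T$ to $v$. For integers $m\ge1$, $h\ge0$, $\mathcal P_{m,h}$ is the set of sequences of $m$ nonnegative integers summing to $h$. *)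

theory Defs
  imports "HOL-Probability.Probability"
begin

(* Finite simple graphs with an explicit vertex set V; E is a set of two-element subsets of V. *)

definition simple_graph :: "'v set \<Rightarrow> 'v set set \<Rightarrow> bool" where
  "simple_graph V E \<longleftrightarrow> finite V \<and> (\<forall>e\<in>E. e \<subseteq> V \<and> card e = 2)"

definition adj_rel :: "'v set set \<Rightarrow> ('v \<times> 'v) set" where
  "adj_rel E = {(u, v). {u, v} \<in> E}"

definition connected_graph :: "'v set \<Rightarrow> 'v set set \<Rightarrow> bool" where
  "connected_graph V E \<longleftrightarrow> V \<noteq> {} \<and> (\<forall>u\<in>V. \<forall>v\<in>V. (u, v) \<in> (adj_rel E)\<^sup>*)"

definition graph_cycle :: "'v set set \<Rightarrow> 'v list \<Rightarrow> bool" where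
  "graph_cycle E xs \<longleftrightarrow> 3 \<le> length xs \<and> distinct xs \<and>
     successively (\<lambda>u v. {u, v} \<in> E) xs \<and> {last xs, hd xs} \<in> E"

definition tree_graph :: "'v set \<Rightarrow> 'v set set \<Rightarrow> bool" where
  "tree_graph V E \<longleftrightarrow> simple_graph V E \<and> connected_graph V E \<and> (\<nexists>xs. graph_cycle E xs)"

(* Minimal number of edges of a walk; meaningful only if u and v are connected. *)
definition graph_dist :: "'v set set \<Rightarrow> 'v \<Rightarrow> 'v \<Rightarrow> nat" where
  "graph_dist E u v = (LEAST k. (u, v) \<in> adj_rel E ^^ k)"

(* A rooted labeled tree on a given vertex set is a pair (root, edge set). *)
type_synonym 'v rtree = "'v \<times> 'v set set"

definition rooted_tree :: "'v set \<Rightarrow> 'v rtree \<Rightarrow> bool" where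
  "rooted_tree V T \<longleftrightarrow> fst T \<in> V \<and> tree_graph V (snd T)"

definition ht :: "'v rtree \<Rightarrow> 'v \<Rightarrow> nat" where
  "ht T v = graph_dist (snd T) (fst T) v"

(* The children of v are its neighbours farther from the root than v. *)
definition child_set :: "'v rtree \<Rightarrow> 'v \<Rightarrow> 'v set" where
  "child_set T v = {w. {v, w} \<in> snd T \<and> ht T w = ht T v + 1}"

(* A sequence (c_v, v : V) is a function of which only the values on V matter.
   The integer casts avoid truncated subtraction. *)
definition child_sequence :: "'v set \<Rightarrow> ('v \<Rightarrow> nat) \<Rightarrow> bool" where
  "child_sequence V c \<longleftrightarrow> finite V \<and> int (\<Sum>v\<in>V. c v) \<le> int (card V) - 1"

definition one_free :: "'v set \<Rightarrow> ('v \<Rightarrow> nat) \<Rightarrow> bool" where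
  "one_free V c \<longleftrightarrow> (\<forall>v\<in>V. c v \<noteq> 1)"

definition trees_with :: "'v set \<Rightarrow> ('v \<Rightarrow> nat) \<Rightarrow> 'v rtree set" where
  "trees_with V c = {T. rooted_tree V T \<and> (\<forall>v\<in>V. card (child_set T v) = c v)}"

definition weak_compositions :: "nat \<Rightarrow> nat \<Rightarrow> nat list set" where
  "weak_compositions m h = {P. length P = m \<and> sum_list P = h}"

definition tree_pairs ::
  "'v set \<Rightarrow> ('v \<Rightarrow> nat) \<Rightarrow> nat \<Rightarrow> 'v \<Rightarrow> ('v rtree \<times> nat list) set" where
  "tree_pairs V c m v = (SIGMA T:trees_with V c. weak_compositions m (ht T v))"

(* The next two lemmas ensure that pmf_of_set (tree_pairs V c m v) is the uniform distribution. *)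

lemma finite_tree_pairs: "finite (tree_pairs V c m v)"
proof (cases "finite V")
  case True
  have "trees_with V c \<subseteq> V \<times> Pow (Pow V)"
    by (force simp: trees_with_def rooted_tree_def tree_graph_def simple_graph_def)
  then have "finite (trees_with V c)"
    using True by (meson finite_Pow_iff finite_SigmaI finite_subset)
  moreover have "finite (weak_compositions m h)" for h
  proof (rule finite_subset)
    show "weak_compositions m h \<subseteq> {P. set P \<subseteq> {..h} \<and> length P = m}"
      by (auto simp: weak_compositions_def dest: member_le_sum_list)
    show "finite {P. set P \<subseteq> {..h} \<and> length P = m}"
      by (rule finite_lists_length_eq) simp
  qed
  ultimately show ?thesis by (auto simp: tree_pairs_def)
next
  case False
  then have "trees_with V c = {}"
    by (auto simp: trees_with_def rooted_tree_def tree_graph_def simple_graph_def)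
  then show ?thesis by (simp add: tree_pairs_def)
qed

lemma tree_pairs_nonempty:
  assumes "trees_with V c \<noteq> {}" and "m \<ge> 1"
  shows "tree_pairs V c m v \<noteq> {}"
proof -
  obtain T where T: "T \<in> trees_with V c" using assms(1) by blast
  have "ht T v # replicate (m - 1) 0 \<in> weak_compositions m (ht T v)"
    using assms(2) by (simp add: weak_compositions_def sum_list_replicate)
  then show ?thesis using T by (auto simp: tree_pairs_def)
qed

end

theory Submission
  imports Defs
begin

text \<open>Let \<open>N h\<close> be the number of trees with child counts \<open>c\<close> that put the vertex \<open>0\<close> at height
  at least \<open>h\<close>, and let \<open>e h\<close> be the \<open>h\<close>-th elementary symmetric polynomial of \<open>c\<close>.
  Deleting leaves one at a time yields the exact count
  \<open>N h * (\<Prod>v. fact (c v)) = fact (n - h) * fact h * e h\<close> (\<open>card_high_trees\<close>): the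
  ancestors of \<open>0\<close> behave like distinct vertices drawn without replacement from a box that
  holds \<open>c v\<close> copies of each \<open>v\<close>.  If no entry of \<open>c\<close> is one, every drawn vertex leaves a further
  copy of itself in the box, so the draws collide quickly and
  \<open>N (h + 1) \<le> (1 - h / n) * N h\<close> (\<open>card_high_trees_step\<close>).

  A tree with \<open>0\<close> at height \<open>h\<close> occurs in \<open>w h = (h + m - 1) choose h\<close> pairs, and in the
  range \<open>h \<ge> 2 * sqrt (m * n)\<close> the ratio \<open>w (h + 1) / w h\<close> is at most \<open>1 + h / (4 * n)\<close>.
  Hence \<open>w h * N h\<close> decreases there by a factor of at most \<open>exp (- 3 * h / (4 * n))\<close> per step,
  and the number of pairs with height at least \<open>h\<close> is at most \<open>4 / 3 * w h * N h\<close>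
  (\<open>weighted_tail_le\<close>).  Going up by \<open>x * sqrt n\<close> from \<open>2 * sqrt (m * n)\<close> therefore costs a
  Gaussian factor of about \<open>exp (- 3 * x^2 / 8)\<close> (\<open>weighted_decay\<close>), compared with all pairs of
  height at least \<open>2 * sqrt (m * n)\<close>.  Since \<open>3 / 8 > 1 / 3\<close>, the constant \<open>4\<close> in the
  exponent absorbs the factor \<open>4 / 3\<close> and the rounding of heights to integers.\<close>

section \<open>Heights in rooted trees\<close>

lemma adj_rel_iff: "(u, v) \<in> adj_rel E \<longleftrightarrow> {u, v} \<in> E"
  by (simp add: adj_rel_def)

lemma sym_adj_rel: "sym (adj_rel E)"
  by (auto simp: sym_def adj_rel_def insert_commute)

lemma graph_dist_walk:
  assumes "(r, v) \<in> (adj_rel E)\<^sup>*"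
  shows "(r, v) \<in> adj_rel E ^^ graph_dist E r v"
  unfolding graph_dist_def using assms by (metis LeastI rtrancl_imp_relpow)

lemma graph_dist_le: "(r, v) \<in> adj_rel E ^^ k \<Longrightarrow> graph_dist E r v \<le> k"
  unfolding graph_dist_def by (rule Least_le)

text \<open>Heights are determined by local conditions.  This is how the heights of a modified tree are
  computed below, without analysing its walks.\<close>

lemma graph_dist_unique:
  assumes root: "d r = 0"
    and edge: "\<And>a b. {a, b} \<in> E \<Longrightarrow> d b \<le> Suc (d a)"
    and pred: "\<And>v. v \<in> V \<Longrightarrow> v \<noteq> r \<Longrightarrow> \<exists>u\<in>V. {u, v} \<in> E \<and> d v = Suc (d u)"
    and v: "v \<in> V"
  shows "(r, v) \<in> adj_rel E ^^ d v" and "graph_dist E r v = d v"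
proof -
  show walk: "(r, v) \<in> adj_rel E ^^ d v"
    using v
  proof (induction "d v" arbitrary: v rule: less_induct)
    case less
    show ?case
    proof (cases "v = r")
      case True
      then show ?thesis using root by simp
    next
      case False
      then obtain u where "u \<in> V" "{u, v} \<in> E" "d v = Suc (d u)"
        using pred less.prems by blast
      then show ?thesis using less.hyps[of u] by (auto simp: adj_rel_iff)
    qed
  qed
  have lower: "d v \<le> k" if "(r, v) \<in> adj_rel E ^^ k" for k v
    using that
  proof (induction k arbitrary: v)
    case 0
    then show ?case using root by simp
  next
    case (Suc k)
    then obtain u where "(r, u) \<in> adj_rel E ^^ k" "{u, v} \<in> E"
      by (auto simp: adj_rel_iff)
    then show ?case using Suc.IH[of u] edge[of u v] by simp
  qed
  show "graph_dist E r v = d v"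
    using graph_dist_le[OF walk] lower graph_dist_walk[OF relpow_imp_rtrancl[OF walk]]
    by (simp add: le_antisym)
qed

lemma rooted_tree_connected:
  "rooted_tree V T \<Longrightarrow> v \<in> V \<Longrightarrow> (fst T, v) \<in> (adj_rel (snd T))\<^sup>*"
  by (simp add: rooted_tree_def tree_graph_def connected_graph_def)

lemma rooted_tree_edge:
  assumes "rooted_tree V T" and "{a, b} \<in> snd T"
  shows "a \<in> V" and "b \<in> V" and "a \<noteq> b"
proof -
  have "{a, b} \<subseteq> V \<and> card {a, b} = 2"
    using assms unfolding rooted_tree_def tree_graph_def simple_graph_def by blast
  then show "a \<in> V" "b \<in> V" "a \<noteq> b" by auto
qed

lemma rooted_tree_root: "rooted_tree V T \<Longrightarrow> fst T \<in> V"
  by (simp add: rooted_tree_def)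

lemma rooted_tree_finite: "rooted_tree V T \<Longrightarrow> finite V"
  by (simp add: rooted_tree_def tree_graph_def simple_graph_def)

lemma ht_root: "ht T (fst T) = 0"
  unfolding ht_def using graph_dist_le[of "fst T" "fst T" 0 "snd T"] by simp

lemma ht_edge:
  assumes "rooted_tree V T" and "{a, b} \<in> snd T"
  shows "ht T b \<le> Suc (ht T a)"
proof -
  have "(fst T, a) \<in> adj_rel (snd T) ^^ ht T a"
    unfolding ht_def
    using graph_dist_walk rooted_tree_connected rooted_tree_edge assms by metis
  then have "(fst T, b) \<in> adj_rel (snd T) ^^ Suc (ht T a)"
    using assms(2) by (auto simp: adj_rel_iff)
  then show ?thesis unfolding ht_def by (rule graph_dist_le)
qed

lemma ht_parent:
  assumes T: "rooted_tree V T" and v: "v \<in> V" "v \<noteq> fst T"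
  shows "\<exists>u\<in>V. {u, v} \<in> snd T \<and> ht T v = Suc (ht T u)"
proof -
  have walk: "(fst T, v) \<in> adj_rel (snd T) ^^ ht T v"
    unfolding ht_def using graph_dist_walk rooted_tree_connected T v by metis
  with v obtain k where k: "ht T v = Suc k" by (cases "ht T v") auto
  with walk obtain u where u: "(fst T, u) \<in> adj_rel (snd T) ^^ k" "{u, v} \<in> snd T"
    by (auto simp: adj_rel_iff)
  have "ht T u \<le> k" unfolding ht_def using u(1) by (rule graph_dist_le)
  then have "ht T v = Suc (ht T u)" using ht_edge[OF T u(2)] k by simp
  then show ?thesis using u rooted_tree_edge(1)[OF T u(2)] by blast
qed

lemma child_set_subset: "rooted_tree V T \<Longrightarrow> child_set T v \<subseteq> V"
  using rooted_tree_edge(2) by (fastforce simp: child_set_def)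

lemma root_has_child:
  assumes T: "rooted_tree V T" and v: "v \<in> V" "v \<noteq> fst T"
  shows "child_set T (fst T) \<noteq> {}"
proof -
  obtain y where y: "{fst T, y} \<in> snd T"
    using rooted_tree_connected[OF T v(1)] v(2)
    by (metis adj_rel_iff converse_rtranclE)
  then have "y \<in> V" "y \<noteq> fst T" using rooted_tree_edge[OF T y] by auto
  then have "ht T y = ht T (fst T) + 1"
    using ht_parent[OF T] ht_edge[OF T y] ht_root[of T] by fastforce
  then show ?thesis using y by (auto simp: child_set_def)
qed

section \<open>Attaching and deleting a leaf\<close>

lemma rtrancl_simple_path:
  assumes "(a, b) \<in> R\<^sup>*"
  shows "\<exists>xs. xs \<noteq> [] \<and> hd xs = a \<and> last xs = b \<and> distinct xs \<and>
    successively (\<lambda>u v. (u, v) \<in> R) xs \<and> set xs \<subseteq> insert b (Domain R)"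
  using assms
proof (induction rule: converse_rtrancl_induct)
  case base
  then show ?case by (intro exI[of _ "[b]"]) auto
next
  case (step a y)
  then obtain xs where xs: "xs \<noteq> []" "hd xs = y" "last xs = b" "distinct xs"
    "successively (\<lambda>u v. (u, v) \<in> R) xs" "set xs \<subseteq> insert b (Domain R)" by blast
  show ?case
  proof (cases "a \<in> set xs")
    case True
    then obtain ys zs where "xs = ys @ a # zs" by (meson split_list)
    then show ?thesis using xs
      by (intro exI[of _ "a # zs"]) (auto simp: successively_append_iff)
  next
    case False
    then show ?thesis using xs step.hyps(1)
      by (intro exI[of _ "a # xs"]) (auto simp: successively_Cons)
  qed
qed

text \<open>A vertex with a single neighbour lies on no cycle, so attaching a leaf creates none.\<close>

lemma graph_cycle_two_neighbours:
  assumes "graph_cycle E xs" and "w \<in> set xs"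
  shows "\<exists>a b. a \<noteq> b \<and> {w, a} \<in> E \<and> {w, b} \<in> E"
proof -
  let ?L = "length xs"
  have L: "3 \<le> ?L" and dist: "distinct xs"
    and suc: "\<And>i. Suc i < ?L \<Longrightarrow> {xs ! i, xs ! Suc i} \<in> E"
    and close: "{last xs, hd xs} \<in> E"
    using assms(1) by (auto simp: graph_cycle_def successively_conv_nth)
  have ne: "xs \<noteq> []" using L by auto
  have wrap: "{xs ! (?L - 1), xs ! 0} \<in> E"
    using close ne by (simp add: last_conv_nth hd_conv_nth)
  obtain i where i: "i < ?L" "w = xs ! i" using assms(2) by (metis in_set_conv_nth)
  define p where "p = (if i = 0 then ?L - 1 else i - 1)"
  define q where "q = (if i = ?L - 1 then 0 else Suc i)"
  have "p < ?L" "q < ?L" "p \<noteq> q" using i L by (auto simp: p_def q_def split: if_splits)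
  then have "xs ! p \<noteq> xs ! q" using dist by (simp add: nth_eq_iff_index_eq)
  moreover have "{w, xs ! p} \<in> E"
    using i wrap suc[of "i - 1"] by (auto simp: p_def insert_commute)
  moreover have "{w, xs ! q} \<in> E"
    using i wrap suc[of i] by (auto simp: q_def insert_commute)
  ultimately show ?thesis by blast
qed

text \<open>A second neighbour of a childless vertex would lie no deeper than that vertex, so both
  neighbours could be joined to the root by descending paths that avoid it; this closes a cycle.\<close>

lemma childless_unique_neighbour:
  assumes T: "rooted_tree V T" and w: "w \<in> V" "w \<noteq> fst T" "child_set T w = {}"
  shows "\<exists>u\<in>V. u \<noteq> w \<and> (\<forall>x. {w, x} \<in> snd T \<longleftrightarrow> x = u)"
proof -
  obtain u where u: "u \<in> V" "{u, w} \<in> snd T" "ht T w = Suc (ht T u)"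
    using ht_parent[OF T w(1,2)] by blast
  define R where "R = adj_rel {e \<in> snd T. w \<notin> e}"
  have symR: "sym R" unfolding R_def by (rule sym_adj_rel)
  have low: "(fst T, v) \<in> R\<^sup>*" if "v \<in> V" "ht T v \<le> ht T w" "v \<noteq> w" for v
    using that
  proof (induction "ht T v" arbitrary: v rule: less_induct)
    case less
    show ?case
    proof (cases "v = fst T")
      case False
      then obtain y where y: "y \<in> V" "{y, v} \<in> snd T" "ht T v = Suc (ht T y)"
        using ht_parent[OF T] less.prems by blast
      then have "y \<noteq> w" using less.prems by auto
      moreover from this have "(fst T, y) \<in> R\<^sup>*" using less y by auto
      moreover have "(y, v) \<in> R" using y less.prems calculation(1) by (auto simp: R_def adj_rel_iff)
      ultimately show ?thesis by auto
    qed auto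
  qed
  have "x = u" if x: "{w, x} \<in> snd T" for x
  proof (rule ccontr)
    assume "x \<noteq> u"
    have "x \<in> V" "x \<noteq> w" using rooted_tree_edge[OF T x] by auto
    moreover have "ht T x \<le> ht T w"
      using ht_edge[OF T x] w(3) x by (fastforce simp: child_set_def le_Suc_eq)
    moreover have "u \<noteq> w" "ht T u \<le> ht T w" using u(3) by auto
    ultimately have "(fst T, x) \<in> R\<^sup>*" "(fst T, u) \<in> R\<^sup>*" using low u(1) by blast+
    then have "(u, x) \<in> R\<^sup>*" using symR by (meson rtrancl_trans symD sym_rtrancl)
    then obtain xs where xs: "xs \<noteq> []" "hd xs = u" "last xs = x" "distinct xs"
      "successively (\<lambda>u v. (u, v) \<in> R) xs" "set xs \<subseteq> insert x (Domain R)"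
      using rtrancl_simple_path by metis
    have "w \<notin> set xs" using xs(6) \<open>x \<noteq> w\<close> by (auto simp: R_def adj_rel_iff)
    moreover have "successively (\<lambda>u v. {u, v} \<in> snd T) xs"
      using xs(5) by (rule successively_mono) (auto simp: R_def adj_rel_iff)
    moreover have "3 \<le> length (w # xs)"
      using xs(1-3) \<open>x \<noteq> u\<close> by (cases xs; cases "tl xs") auto
    ultimately have "graph_cycle (snd T) (w # xs)"
      using xs u x by (auto simp: graph_cycle_def successively_Cons insert_commute)
    then show False using T by (auto simp: rooted_tree_def tree_graph_def)
  qed
  moreover have "u \<noteq> w" using u by auto
  ultimately show ?thesis using u by (metis insert_commute)
qed

definition attach_leaf :: "'v \<Rightarrow> 'v \<Rightarrow> 'v rtree \<Rightarrow> 'v rtree" where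
  "attach_leaf u w T = (fst T, insert {u, w} (snd T))"

lemma tree_graph_of_levels:
  assumes "simple_graph V E" and "\<nexists>xs. graph_cycle E xs" and r: "r \<in> V"
    and "d r = 0"
    and "\<And>a b. {a, b} \<in> E \<Longrightarrow> d b \<le> Suc (d a)"
    and "\<And>v. v \<in> V \<Longrightarrow> v \<noteq> r \<Longrightarrow> \<exists>u\<in>V. {u, v} \<in> E \<and> d v = Suc (d u)"
  shows "rooted_tree V (r, E)"
proof -
  have reach: "(r, v) \<in> (adj_rel E)\<^sup>*" if "v \<in> V" for v
    using graph_dist_unique(1)[of d r E V v] assms that by (meson relpow_imp_rtrancl)
  have "(u, v) \<in> (adj_rel E)\<^sup>*" if "u \<in> V" "v \<in> V" for u v
    using reach[OF that(1)] reach[OF that(2)] sym_adj_rel[of E]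
    by (meson rtrancl_trans symD sym_rtrancl)
  then show ?thesis using assms(1-3)
    by (auto simp: rooted_tree_def tree_graph_def connected_graph_def)
qed

lemma
  assumes T: "rooted_tree V T" and w: "w \<notin> V" and u: "u \<in> V"
  shows rooted_tree_attach_leaf: "rooted_tree (insert w V) (attach_leaf u w T)"
    and ht_attach_leaf: "v \<in> V \<Longrightarrow> ht (attach_leaf u w T) v = ht T v"
    and ht_attach_leaf_new: "ht (attach_leaf u w T) w = Suc (ht T u)"
proof -
  define d where "d = (ht T)(w := Suc (ht T u))"
  define E where "E = insert {u, w} (snd T)"
  have dV: "d v = ht T v" if "v \<in> V" for v using that w by (auto simp: d_def)
  have dw: "d w = Suc (ht T u)" by (simp add: d_def)
  have rV: "fst T \<in> V" by (rule rooted_tree_root[OF T])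
  have old: "{a, b} \<in> snd T \<or> (a = u \<and> b = w) \<or> (a = w \<and> b = u)" if "{a, b} \<in> E" for a b
    using that by (auto simp: E_def doubleton_eq_iff)
  have root: "d (fst T) = 0" using dV[OF rV] ht_root by metis
  have edge: "d b \<le> Suc (d a)" if "{a, b} \<in> E" for a b
    using old[OF that] dV[OF u] dw ht_edge[OF T, of a b] rooted_tree_edge[OF T, of a b] dV by auto
  have pred: "\<exists>y\<in>insert w V. {y, v} \<in> E \<and> d v = Suc (d y)"
    if "v \<in> insert w V" "v \<noteq> fst T" for v
  proof (cases "v = w")
    case True
    then show ?thesis using u dw dV by (auto simp: E_def)
  next
    case False
    then show ?thesis using ht_parent[OF T _ that(2)] that(1) dV by (fastforce simp: E_def)
  qed
  have simple: "simple_graph (insert w V) E"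
    using T u w by (auto simp: rooted_tree_def tree_graph_def simple_graph_def E_def card_2_iff)
  have "\<not> graph_cycle E xs" for xs
  proof
    assume cyc: "graph_cycle E xs"
    have nbr: "a = u" if "{w, a} \<in> E" for a
      using old[OF that] rooted_tree_edge[OF T, of w a] w by auto
    then have "w \<notin> set xs" using graph_cycle_two_neighbours[OF cyc] by metis
    then have keep: "{a, b} \<in> snd T" if "a \<in> set xs" "b \<in> set xs" "{a, b} \<in> E" for a b
      using old[OF that(3)] that(1,2) by auto
    have "xs \<noteq> []" using cyc by (auto simp: graph_cycle_def)
    then have "{last xs, hd xs} \<in> snd T" using cyc keep by (auto simp: graph_cycle_def)
    moreover have "successively (\<lambda>a b. {a, b} \<in> snd T) xs"
      by (rule successively_mono[of "\<lambda>a b. {a, b} \<in> E"])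
        (use cyc keep in \<open>auto simp: graph_cycle_def\<close>)
    ultimately have "graph_cycle (snd T) xs" using cyc by (simp add: graph_cycle_def)
    then show False using T by (auto simp: rooted_tree_def tree_graph_def)
  qed
  then show "rooted_tree (insert w V) (attach_leaf u w T)"
    using tree_graph_of_levels[OF simple _ _ root edge pred] rV
    by (auto simp: attach_leaf_def E_def)
  have "ht (attach_leaf u w T) v = d v" if "v \<in> insert w V" for v
    using graph_dist_unique(2)[OF root edge pred that]
    by (simp add: ht_def attach_leaf_def E_def)
  then show "v \<in> V \<Longrightarrow> ht (attach_leaf u w T) v = ht T v"
    and "ht (attach_leaf u w T) w = Suc (ht T u)" using dV dw by auto
qed

lemma card_child_set_attach_leaf:
  assumes T: "rooted_tree V T" and w: "w \<notin> V" and u: "u \<in> V" and v: "v \<in> insert w V"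
  shows "card (child_set (attach_leaf u w T) v) =
    (if v = w then 0 else if v = u then Suc (card (child_set T v)) else card (child_set T v))"
proof -
  note hts = ht_attach_leaf[OF T w u] ht_attach_leaf_new[OF T w u]
  have edges: "{a, b} \<in> snd (attach_leaf u w T) \<longleftrightarrow>
      {a, b} \<in> snd T \<or> (a = u \<and> b = w) \<or> (a = w \<and> b = u)" for a b
    by (auto simp: attach_leaf_def doubleton_eq_iff)
  have inV: "a \<in> V \<and> b \<in> V" if "{a, b} \<in> snd T" for a b
    using rooted_tree_edge[OF T that] by simp
  have "child_set (attach_leaf u w T) v =
      (if v = w then {} else if v = u then insert w (child_set T v) else child_set T v)"
    unfolding child_set_def edges using hts inV u w v by auto
  moreover have "finite (child_set T v)" "w \<notin> child_set T v"
    using child_set_subset[OF T, of v] w finite_subset[OF _ rooted_tree_finite[OF T]] by auto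
  ultimately show ?thesis by auto
qed

lemma delete_leaf:
  assumes T: "rooted_tree (insert w V) T" and w: "w \<notin> V" "w \<noteq> fst T" "child_set T w = {}"
  shows "\<exists>u\<in>V. \<exists>T'. rooted_tree V T' \<and> T = attach_leaf u w T'"
proof -
  obtain u where u: "u \<in> insert w V" "u \<noteq> w" and nbr: "\<And>x. {w, x} \<in> snd T \<longleftrightarrow> x = u"
    using childless_unique_neighbour[OF T _ w(2,3)] by blast
  define E where "E = snd T - {{u, w}}"
  have uw: "{u, w} \<in> snd T" using nbr by (metis insert_commute)
  have Ew: "a \<noteq> w \<and> b \<noteq> w" if "{a, b} \<in> E" for a b
    using that nbr[of a] nbr[of b] by (auto simp: E_def insert_commute)
  have "simple_graph V E"
    unfolding simple_graph_def
  proof (intro conjI ballI)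
    show "finite V" using rooted_tree_finite[OF T] by simp
    fix e assume e: "e \<in> E"
    then have e2: "e \<subseteq> insert w V" "card e = 2"
      using T by (auto simp: E_def rooted_tree_def tree_graph_def simple_graph_def)
    then obtain a b where "e = {a, b}" by (auto simp: card_2_iff)
    then show "e \<subseteq> V" using Ew e e2 by auto
    show "card e = 2" by fact
  qed
  moreover have "\<nexists>xs. graph_cycle E xs"
  proof
    assume "\<exists>xs. graph_cycle E xs"
    then obtain xs where "graph_cycle E xs" ..
    then have "graph_cycle (snd T) xs"
      unfolding graph_cycle_def by (auto elim!: successively_mono simp: E_def)
    then show False using T by (auto simp: rooted_tree_def tree_graph_def)
  qed
  moreover have "fst T \<in> V" using rooted_tree_root[OF T] w(2) by auto
  moreover note ht_root[of T]
  moreover have "ht T b \<le> Suc (ht T a)" if "{a, b} \<in> E" for a b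
    using that ht_edge[OF T, of a b] by (simp add: E_def)
  moreover have "\<exists>y\<in>V. {y, v} \<in> E \<and> ht T v = Suc (ht T y)" if v: "v \<in> V" "v \<noteq> fst T" for v
  proof -
    obtain y where y: "y \<in> insert w V" "{y, v} \<in> snd T" "ht T v = Suc (ht T y)"
      using ht_parent[OF T _ v(2)] v(1) by blast
    have "y \<noteq> w" using y w(3) by (auto simp: child_set_def)
    moreover have "v \<noteq> w" using v w by auto
    ultimately show ?thesis using y by (auto simp: E_def doubleton_eq_iff)
  qed
  ultimately have "rooted_tree V (fst T, E)" by (rule tree_graph_of_levels)
  moreover have "T = attach_leaf u w (fst T, E)"
    using uw by (auto simp: attach_leaf_def E_def insert_absorb)
  ultimately show ?thesis using u by blast
qed

lemma finite_trees_with: "finite (trees_with V c)"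
proof (cases "finite V")
  case True
  have "trees_with V c \<subseteq> V \<times> Pow (Pow V)"
    by (force simp: trees_with_def rooted_tree_def tree_graph_def simple_graph_def)
  then show ?thesis
    using True by (meson finite_Pow_iff finite_SigmaI finite_subset)
next
  case False
  then have "trees_with V c = {}" unfolding trees_with_def using rooted_tree_finite by blast
  then show ?thesis by simp
qed

text \<open>Deleting the leaf \<open>w\<close> lowers the child count of its parent \<open>u\<close> by one and leaves all other
  child counts alone; \<open>w\<close> is not the root, because the root of a tree with several vertices has a
  child.\<close>

lemma trees_with_insert_leaf:
  assumes fin: "finite V" and ne: "V \<noteq> {}" and w: "w \<notin> V" and cw: "c w = 0"
  shows "trees_with (insert w V) c =
    (\<Union>u\<in>{u \<in> V. 0 < c u}. attach_leaf u w ` trees_with V (c(u := c u - 1)))" (is "?L = ?R")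
proof
  show "?L \<subseteq> ?R"
  proof
    fix T assume "T \<in> ?L"
    then have T: "rooted_tree (insert w V) T"
      and c: "\<And>v. v \<in> insert w V \<Longrightarrow> card (child_set T v) = c v"
      by (auto simp: trees_with_def)
    have fin: "finite (child_set T v)" for v
      using child_set_subset[OF T] rooted_tree_finite[OF T] by (rule finite_subset)
    have leaf: "child_set T w = {}" using c[of w] cw fin[of w] by simp
    have "w \<noteq> fst T"
    proof
      assume eq: "w = fst T"
      obtain v where "v \<in> V" using ne by blast
      then show False using root_has_child[OF T, of v] w leaf eq by auto
    qed
    then obtain u T' where u: "u \<in> V" and T': "rooted_tree V T'" "T = attach_leaf u w T'"
      using delete_leaf[OF T w _ leaf] by blast
    have c': "c v = (if v = u then Suc (card (child_set T' v)) else card (child_set T' v))"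
      if "v \<in> V" for v
      using card_child_set_attach_leaf[OF T'(1) w u, of v] c[of v] that w T'(2) by (metis insertI2)
    have "T' \<in> trees_with V (c(u := c u - 1))"
      using T'(1) c' by (auto simp: trees_with_def)
    moreover have "0 < c u" using c'[OF u] by simp
    ultimately show "T \<in> ?R" using u T'(2) by blast
  qed
  show "?R \<subseteq> ?L"
  proof
    fix T assume "T \<in> ?R"
    then obtain u T' where u: "u \<in> V" "0 < c u" and T': "T' \<in> trees_with V (c(u := c u - 1))"
      and T: "T = attach_leaf u w T'" by blast
    from T' have rt: "rooted_tree V T'"
      and c: "\<And>v. v \<in> V \<Longrightarrow> card (child_set T' v) = (c(u := c u - 1)) v"
      by (auto simp: trees_with_def)
    show "T \<in> ?L"
      unfolding trees_with_def T
      using rooted_tree_attach_leaf[OF rt w u(1)] card_child_set_attach_leaf[OF rt w u(1)] c u cw w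
      by auto
  qed
qed

lemma sum_trees_insert_leaf:
  fixes f :: "'v rtree \<Rightarrow> nat"
  assumes fin: "finite V" and ne: "V \<noteq> {}" and w: "w \<notin> V" and cw: "c w = 0"
  shows "(\<Sum>T\<in>trees_with (insert w V) c. f T) =
    (\<Sum>u\<in>{u \<in> V. 0 < c u}. \<Sum>T\<in>trees_with V (c(u := c u - 1)). f (attach_leaf u w T))"
proof -
  have sub: "w \<notin> \<Union> (snd T)" if "T \<in> trees_with V c'" for T c'
    using that w by (auto simp: trees_with_def rooted_tree_def tree_graph_def simple_graph_def)
  have inj: "inj_on (attach_leaf u w) (trees_with V c')" for u c'
  proof (rule inj_onI)
    fix S T assume ST: "S \<in> trees_with V c'" "T \<in> trees_with V c'"
      and eq: "attach_leaf u w S = attach_leaf u w T"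
    have "{u, w} \<notin> snd S" "{u, w} \<notin> snd T" using sub[OF ST(1)] sub[OF ST(2)] by auto
    then show "S = T" using eq by (auto simp: attach_leaf_def prod_eq_iff insert_ident)
  qed
  have disj: "attach_leaf u w ` trees_with V c1 \<inter> attach_leaf u' w ` trees_with V c2 = {}"
    if "u \<in> V" "u' \<in> V" "u \<noteq> u'" for u u' c1 c2
  proof -
    have False if "S \<in> trees_with V c1" "T \<in> trees_with V c2"
      "attach_leaf u w S = attach_leaf u' w T" for S T
    proof -
      have "{u, w} \<in> insert {u', w} (snd T)" using that(3) by (auto simp: attach_leaf_def)
      then show False using sub[OF that(2)] \<open>u \<noteq> u'\<close> w \<open>u \<in> V\<close> by (auto simp: doubleton_eq_iff)
    qed
    then show ?thesis by blast
  qed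
  show ?thesis
    unfolding trees_with_insert_leaf[OF fin ne w, of c, OF cw]
    by (subst sum.UNION_disjoint)
      (use fin finite_trees_with disj inj in \<open>auto simp: sum.reindex\<close>)
qed


section \<open>How many trees put a given leaf at height at least \<open>h\<close>\<close>

definition elem_sym :: "'v set \<Rightarrow> ('v \<Rightarrow> nat) \<Rightarrow> nat \<Rightarrow> nat" where
  "elem_sym V c h = (\<Sum>A | A \<subseteq> V \<and> card A = h. \<Prod>v\<in>A. c v)"

definition high_trees :: "'v set \<Rightarrow> ('v \<Rightarrow> nat) \<Rightarrow> 'v \<Rightarrow> nat \<Rightarrow> 'v rtree set" where
  "high_trees V c z h = {T \<in> trees_with V c. h \<le> ht T z}"

lemma elem_sym_insert_zero:
  assumes "finite V" and "w \<notin> V" and "c w = 0"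
  shows "elem_sym (insert w V) c h = elem_sym V c h"
  unfolding elem_sym_def
proof (rule sum.mono_neutral_right)
  show "finite {A. A \<subseteq> insert w V \<and> card A = h}" using assms(1) by simp
  show "{A. A \<subseteq> V \<and> card A = h} \<subseteq> {A. A \<subseteq> insert w V \<and> card A = h}" by auto
  show "\<forall>A\<in>{A. A \<subseteq> insert w V \<and> card A = h} - {A. A \<subseteq> V \<and> card A = h}. prod c A = 0"
  proof
    fix A assume A: "A \<in> {A. A \<subseteq> insert w V \<and> card A = h} - {A. A \<subseteq> V \<and> card A = h}"
    then have "w \<in> A" "finite A" using assms(1) by (auto dest: finite_subset)
    then show "prod c A = 0" using assms(3) prod_zero by blast
  qed
qed

lemma elem_sym_eq_0:
  assumes fin: "finite V" and z: "z \<in> V" "c z = 0" and h: "card V \<le> h"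
  shows "elem_sym V c h = 0"
proof -
  have "prod c A = 0" if "A \<subseteq> V" "card A = h" for A
  proof -
    have "A = V" using card_seteq[OF fin that(1)] that(2) h by simp
    then show ?thesis using fin z by (metis prod_zero)
  qed
  then show ?thesis by (simp add: elem_sym_def)
qed

lemma elem_sym_ones:
  assumes "finite V" and "u \<in> V" and "\<And>v. v \<in> V \<Longrightarrow> c v = (if v = u then 0 else 1)"
  shows "elem_sym V c h = (card V - 1) choose h"
proof -
  have "V = insert u (V - {u})" using assms(2) by auto
  then have "elem_sym V c h = elem_sym (V - {u}) c h"
    using elem_sym_insert_zero[of "V - {u}" u c h] assms by simp
  also have "\<dots> = (\<Sum>A | A \<subseteq> V - {u} \<and> card A = h. 1)"
    unfolding elem_sym_def
  proof (intro sum.cong refl prod.neutral ballI)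
    fix A x assume "A \<in> {A. A \<subseteq> V - {u} \<and> card A = h}" "x \<in> A"
    then have "x \<in> V" "x \<noteq> u" by auto
    then show "c x = 1" using assms(3) by simp
  qed
  also have "\<dots> = (card V - 1) choose h"
    using n_subsets[of "V - {u}" h] assms by simp
  finally show ?thesis .
qed

text \<open>The factor \<open>c u\<close> counts the choices of a unit to remove from \<open>c\<close>.  A monomial of the
  elementary symmetric polynomial survives the removal of a unit outside its support and loses
  one unit of freedom for each index of its support, whence the factor \<open>sum c V - h\<close>.\<close>

lemma elem_sym_remove_unit:
  assumes fin: "finite V"
  shows "(\<Sum>u\<in>V. c u * elem_sym V (c(u := c u - 1)) h) = (sum c V - h) * elem_sym V c h"
proof -
  have mono: "(\<Sum>u\<in>V. c u * prod (c(u := c u - 1)) A) = (sum c V - h) * prod c A"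
    if A: "A \<subseteq> V" "card A = h" for A
  proof -
    have finA: "finite A" using A(1) fin by (rule finite_subset)
    show ?thesis
    proof (cases "\<exists>a\<in>A. c a = 0")
      case True
      then obtain a where a: "a \<in> A" "c a = 0" by blast
      have "prod (c(u := c u - 1)) A = 0" for u
        by (rule prod_zero[OF finA]) (use a in \<open>auto intro!: bexI[of _ a]\<close>)
      moreover have "prod c A = 0" using a finA prod_zero by blast
      ultimately show ?thesis by simp
    next
      case False
      then have pos: "1 \<le> c a" if "a \<in> A" for a using that by (metis One_nat_def Suc_leI not_gr_zero)
      have inside: "c u * prod (c(u := c u - 1)) A = (c u - 1) * prod c A" if u: "u \<in> A" for u
      proof -
        have "prod (c(u := c u - 1)) (A - {u}) = prod c (A - {u})" by (rule prod.cong) auto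
        then show ?thesis using prod.remove[OF finA u, of c]
            prod.remove[OF finA u, of "c(u := c u - 1)"] by simp
      qed
      have outside: "c u * prod (c(u := c u - 1)) A = c u * prod c A" if u: "u \<notin> A" for u
      proof -
        have "prod (c(u := c u - 1)) A = prod c A" by (rule prod.cong) (use u in auto)
        then show ?thesis by simp
      qed
      have split: "sum f V = sum f (V - A) + sum f A" for f :: "_ \<Rightarrow> nat"
        by (rule sum.subset_diff[OF A(1) fin])
      have "(\<Sum>u\<in>V. c u * prod (c(u := c u - 1)) A) =
          (\<Sum>u\<in>V - A. c u * prod c A) + (\<Sum>u\<in>A. (c u - 1) * prod c A)"
        unfolding split using inside outside by (intro arg_cong2[where f = "(+)"] sum.cong) auto
      also have "\<dots> = ((\<Sum>u\<in>V - A. c u) + (\<Sum>u\<in>A. c u - 1)) * prod c A"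
        by (simp add: sum_distrib_right distrib_right)
      also have "(\<Sum>u\<in>A. c u - 1) = sum c A - h"
        using sum_subtractf_nat[of A "\<lambda>_. 1" c] pos A(2) by simp
      also have "(\<Sum>u\<in>V - A. c u) + (sum c A - h) = sum c V - h"
      proof -
        have "h \<le> sum c A" using sum_mono[of A "\<lambda>_. 1" c] pos A(2) by simp
        then show ?thesis using split[of c] by simp
      qed
      finally show ?thesis .
    qed
  qed
  have "(\<Sum>u\<in>V. c u * elem_sym V (c(u := c u - 1)) h) =
      (\<Sum>A | A \<subseteq> V \<and> card A = h. \<Sum>u\<in>V. c u * prod (c(u := c u - 1)) A)"
    unfolding elem_sym_def sum_distrib_left by (rule sum.swap)
  also have "\<dots> = (sum c V - h) * elem_sym V c h"
    unfolding elem_sym_def sum_distrib_left using mono by (intro sum.cong) auto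
  finally show ?thesis .
qed

lemma card_high_trees_sum:
  "card (high_trees V c z h) = (\<Sum>T\<in>trees_with V c. of_bool (h \<le> ht T z))"
proof -
  have "(\<Sum>T\<in>trees_with V c. of_bool (h \<le> ht T z)) = (\<Sum>T\<in>high_trees V c z h. 1::nat)"
    by (rule sum.mono_neutral_cong_right) (auto simp: high_trees_def finite_trees_with)
  then show ?thesis by simp
qed

lemma card_high_trees_insert_other:
  assumes "finite V" and "z \<in> V" and "w \<notin> V" and "c w = 0"
  shows "card (high_trees (insert w V) c z h) =
    (\<Sum>u\<in>{u \<in> V. 0 < c u}. card (high_trees V (c(u := c u - 1)) z h))"
proof -
  have "V \<noteq> {}" using assms(2) by auto
  note sum_trees_insert_leaf[OF assms(1) this assms(3), of c, OF assms(4)]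
  then show ?thesis
    unfolding card_high_trees_sum
    using ht_attach_leaf[OF _ assms(3) _ assms(2)] by (auto simp: trees_with_def intro!: sum.cong)
qed

lemma card_high_trees_insert_self:
  assumes "finite V" and "V \<noteq> {}" and "z \<notin> V" and "c z = 0"
  shows "card (high_trees (insert z V) c z h) =
    (\<Sum>u\<in>{u \<in> V. 0 < c u}. card (high_trees V (c(u := c u - 1)) u (h - 1)))"
  unfolding card_high_trees_sum sum_trees_insert_leaf[OF assms(1-3), of c, OF assms(4)]
  using ht_attach_leaf_new[OF _ assms(3)]
  by (intro sum.cong refl) (auto simp: trees_with_def le_diff_conv)

lemma trees_with_singleton: "trees_with {z} c = (if c z = 0 then {(z, {})} else {})"
proof -
  have "T = (z, {})" if "rooted_tree {z} T" for T
  proof -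
    have "e \<subseteq> {z} \<and> card e = 2" if "e \<in> snd T" for e
      using \<open>rooted_tree {z} T\<close> that by (auto simp: rooted_tree_def tree_graph_def simple_graph_def)
    then have "snd T = {}" by (metis card.empty card.insert empty_iff equals0I finite.emptyI
          nat.distinct(1) numeral_2_eq_2 old.nat.inject subset_singletonD)
    moreover have "fst T = z" using rooted_tree_root[OF that] by simp
    ultimately show ?thesis by (simp add: prod_eq_iff)
  qed
  moreover have "rooted_tree {z} (z, {})"
    by (auto simp: rooted_tree_def tree_graph_def simple_graph_def connected_graph_def
        graph_cycle_def)
  moreover have "child_set (z, {}) z = {}" by (simp add: child_set_def)
  ultimately have "child_set (z, {}) z = {}" "rooted_tree {z} T \<longleftrightarrow> T = (z, {})" for T
    by blast+
  then show ?thesis by (auto simp: trees_with_def)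
qed

text \<open>Both sides obey the same recursion under the deletion of a leaf.  Any leaf other than \<open>z\<close> may
  be deleted without changing the height of \<open>z\<close>.  If \<open>z\<close> is the only leaf, then all trees are
  paths, and deleting \<open>z\<close> turns its parent into the only leaf of a shorter path.

  In probabilistic terms the formula says that \<open>z\<close> has height at least \<open>h\<close> with the
  probability that \<open>h\<close> draws without replacement from \<open>c v\<close> copies of each vertex \<open>v\<close> give distinct
  vertices.\<close>

lemma card_high_trees:
  assumes "finite V" and "z \<in> V" and "c z = 0" and "sum c V = card V - 1"
  shows "card (high_trees V c z h) * (\<Prod>v\<in>V. fact (c v)) =
    fact (card V - 1 - h) * fact h * elem_sym V c h"
  using assms
proof (induction "card V" arbitrary: V c z h rule: less_induct)
  case less
  note fin = less.prems(1)
  show ?case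
  proof (cases "V = {z}")
    case True
    have "ht (z, {}) z = 0" using ht_root[of "(z, {})"] by simp
    then have "high_trees V c z h = (if h = 0 then {(z, {})} else {})"
      using True less.prems by (auto simp: high_trees_def trees_with_singleton)
    moreover have "elem_sym V c h = (if h = 0 then 1 else 0)"
    proof (cases "h = 0")
      case True
      then have "{A. A \<subseteq> V \<and> card A = h} = {{}}" using fin by (auto dest: finite_subset)
      then show ?thesis using True by (simp add: elem_sym_def)
    next
      case False
      then show ?thesis using elem_sym_eq_0[OF fin less.prems(2), of c, OF less.prems(3)] True by simp
    qed
    ultimately show ?thesis using True less.prems by simp
  next
    case False
    show ?thesis
    proof (cases "\<exists>w\<in>V. w \<noteq> z \<and> c w = 0")
      case True
      then obtain w where w: "w \<in> V" "w \<noteq> z" "c w = 0" by blast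
      define U where "U = V - {w}"
      have U: "V = insert w U" "w \<notin> U" "finite U" "z \<in> U" "card V = Suc (card U)"
        using w less.prems(1,2) card_Suc_Diff1[OF fin w(1)] by (auto simp: U_def)
      have sumU: "sum c U = card U" using less.prems(4) U(2,3,5) w(3) by (simp add: U(1))
      have factU: "(\<Prod>v\<in>V. fact (c v)) = ((\<Prod>v\<in>U. fact (c v)) :: nat)"
        using U(1-3) w(3) by simp
      have step: "card (high_trees U (c(u := c u - 1)) z h) * (\<Prod>v\<in>U. fact (c v)) =
          c u * (fact (card U - 1 - h) * fact h * elem_sym U (c(u := c u - 1)) h)"
        if u: "u \<in> U" "0 < c u" for u
      proof -
        let ?c = "c(u := c u - 1)"
        have sum': "sum ?c U = card U - 1"
        proof -
          have "sum ?c (U - {u}) = sum c (U - {u})" by (rule sum.cong) auto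
          then show ?thesis using sum.remove[OF U(3) u(1), of c]
              sum.remove[OF U(3) u(1), of ?c] u sumU by simp
        qed
        have "(\<Prod>v\<in>U. fact (c v)) = (c u * (\<Prod>v\<in>U. fact (?c v)) :: nat)"
        proof -
          have "(\<Prod>v\<in>U - {u}. fact (?c v)) = ((\<Prod>v\<in>U - {u}. fact (c v)) :: nat)"
            by (rule prod.cong) auto
          then show ?thesis using prod.remove[OF U(3) u(1), of "\<lambda>v. fact (c v) :: nat"]
              prod.remove[OF U(3) u(1), of "\<lambda>v. fact (?c v) :: nat"] u
            by (simp add: fact_reduce)
        qed
        moreover have "card (high_trees U ?c z h) * (\<Prod>v\<in>U. fact (?c v)) =
            fact (card U - 1 - h) * fact h * elem_sym U ?c h"
        proof (rule less.hyps)
          show "?c z = 0" using less.prems(3) u by auto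
        qed (use U sum' in auto)
        ultimately show ?thesis by (simp add: mult.left_commute)
      qed
      have "card (high_trees V c z h) * (\<Prod>v\<in>V. fact (c v)) =
          (\<Sum>u\<in>{u \<in> U. 0 < c u}.
            card (high_trees U (c(u := c u - 1)) z h) * (\<Prod>v\<in>U. fact (c v)))"
        using card_high_trees_insert_other[OF U(3,4,2), of c, OF w(3)] U(1) factU
        by (simp add: sum_distrib_right)
      also have "\<dots> = (\<Sum>u\<in>{u \<in> U. 0 < c u}.
          c u * (fact (card U - 1 - h) * fact h * elem_sym U (c(u := c u - 1)) h))"
        using step by simp
      also have "\<dots> = (\<Sum>u\<in>U. c u * (fact (card U - 1 - h) * fact h * elem_sym U (c(u := c u - 1)) h))"
        by (rule sum.mono_neutral_left) (use U in auto)
      also have "\<dots> = fact (card U - 1 - h) * fact h * (\<Sum>u\<in>U. c u * elem_sym U (c(u := c u - 1)) h)"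
        by (simp add: sum_distrib_left mult_ac)
      also have "\<dots> = fact (card U - 1 - h) * fact h * ((card U - h) * elem_sym U c h)"
        using elem_sym_remove_unit[OF U(3)] sumU by simp
      also have "\<dots> = fact (card U - h) * fact h * elem_sym U c h"
      proof (cases "h < card U")
        case True
        then show ?thesis by (simp add: fact_reduce[of "card U - h"] diff_right_commute)
      next
        case False
        then show ?thesis using elem_sym_eq_0[OF U(3,4), of c, OF less.prems(3)] by simp
      qed
      finally show ?thesis using elem_sym_insert_zero[OF U(3,2), of c, OF w(3)] U by simp
    next
      case no_other_leaf: False
      define U where "U = V - {z}"
      have U: "V = insert z U" "z \<notin> U" "finite U" "U \<noteq> {}" "card V = Suc (card U)"
        using less.prems(1,2) False card_Suc_Diff1[OF fin less.prems(2)] by (auto simp: U_def)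
      have sumU: "sum c U = card U" using less.prems(3,4) U(2,3,5) by (simp add: U(1))
      have pos: "1 \<le> c v" if "v \<in> U" for v
        using that no_other_leaf U_def by (metis DiffD1 DiffD2 One_nat_def Suc_leI not_gr_zero singletonI)
      have one: "c v = 1" if "v \<in> U" for v
      proof -
        \<comment> \<open>The excesses over one add up to zero, so each of them vanishes.\<close>
        have "sum (\<lambda>v. c v - 1) U = 0"
          using sum_subtractf_nat[of U "\<lambda>_. 1" c] pos sumU by simp
        then show ?thesis using that pos[OF that] U(3) by (simp add: le_antisym)
      qed
      have step: "card (high_trees U (c(u := c u - 1)) u (h - 1)) =
          fact (card U - 1 - (h - 1)) * fact (h - 1) * ((card U - 1) choose (h - 1))"
        if u: "u \<in> U" for u
      proof -
        let ?c = "c(u := c u - 1)"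
        have val: "?c v = (if v = u then 0 else 1)" if "v \<in> U" for v using one[OF that] one[OF u] by auto
        have "sum ?c (U - {u}) = (\<Sum>v\<in>U - {u}. 1)"
        proof (rule sum.cong[OF refl])
          fix v assume "v \<in> U - {u}"
          then show "?c v = 1" using val[of v] by simp
        qed
        moreover have "?c u = 0" using val[OF u] by simp
        ultimately have "sum ?c U = (\<Sum>v\<in>U - {u}. 1)"
          using sum.remove[OF U(3) u, of ?c] by (simp only: add_0)
        then have sum': "sum ?c U = card U - 1" using u U(3) by simp
        have "(\<Prod>v\<in>U. fact (?c v)) = (1::nat)"
          by (rule prod.neutral) (use val in auto)
        moreover have "card (high_trees U ?c u (h - 1)) * (\<Prod>v\<in>U. fact (?c v)) =
            fact (card U - 1 - (h - 1)) * fact (h - 1) * elem_sym U ?c (h - 1)"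
        proof (rule less.hyps)
          show "?c u = 0" using val[OF u] by simp
        qed (fact sum' | use U(3,5) u in simp)+
        ultimately show ?thesis using elem_sym_ones[OF U(3) u, of ?c, OF val] by simp
      qed
      have "card (high_trees V c z h) = (\<Sum>u\<in>{u \<in> U. 0 < c u}.
          card (high_trees U (c(u := c u - 1)) u (h - 1)))"
        using card_high_trees_insert_self[OF U(3,4,2), of c, OF less.prems(3)] U(1) by simp
      also have "{u \<in> U. 0 < c u} = U" using one by auto
      also have "(\<Sum>u\<in>U. card (high_trees U (c(u := c u - 1)) u (h - 1))) =
          card U * (fact (card U - 1 - (h - 1)) * fact (h - 1) * ((card U - 1) choose (h - 1)))"
        using step by simp
      also have "\<dots> = fact (card U - h) * fact h * (card U choose h)"
      proof (cases "h \<le> card U")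
        case True
        have "card U > 0" using U by auto
        moreover have "h - 1 \<le> card U - 1" using True by simp
        ultimately show ?thesis
          using binomial_fact_lemma[OF \<open>h - 1 \<le> card U - 1\<close>] binomial_fact_lemma[OF True]
          by (simp add: mult_ac fact_reduce[of "card U"])
      next
        case False
        moreover have "0 < card U" using U(3,4) by (simp add: card_gt_0_iff)
        ultimately have "card U - 1 < h - 1" "card U < h" by linarith+
        then show ?thesis by (simp add: binomial_eq_0)
      qed
      also have "card U choose h = elem_sym V c h"
      proof -
        have "c v = (if v = z then 0 else 1)" if "v \<in> V" for v
        proof (cases "v = z")
          case False
          then have "v \<in> U" using that by (simp add: U_def)
          then show ?thesis using False one by simp
        qed (simp add: less.prems(3))
        from elem_sym_ones[OF fin less.prems(2), of c, OF this] show ?thesis using U(5) by simp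
      qed
      finally have "card (high_trees V c z h) = fact (card U - h) * fact h * elem_sym V c h" .
      moreover have "(\<Prod>v\<in>V. fact (c v)) = (1::nat)"
        unfolding U(1) using U(2,3) one less.prems(3) by simp
      ultimately show ?thesis using U(5) by simp
    qed
  qed
qed

text \<open>A set of \<open>h\<close> vertices with nonzero product has total weight at least \<open>2 * h\<close>, because no
  entry of \<open>c\<close> equals one.  This is where one-freeness enters.\<close>

lemma elem_sym_step_one_free:
  assumes fin: "finite V" and free: "one_free V c"
  shows "Suc h * elem_sym V c (Suc h) \<le> (sum c V - 2 * h) * elem_sym V c h"
proof -
  let ?S = "\<lambda>h. {A. A \<subseteq> V \<and> card A = h}"
  have finS: "finite (?S k)" for k using fin by simp
  \<comment> \<open>Both sums run over a set of \<open>h\<close> vertices and one further vertex.\<close>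
  have bij: "bij_betw (\<lambda>(A, u). (insert u A, u)) (SIGMA A:?S h. V - A) (SIGMA B:?S (Suc h). B)"
    by (rule bij_betw_byWitness[where f' = "\<lambda>(B, u). (B - {u}, u)"])
      (use fin in \<open>auto simp: card_insert_if dest: finite_subset\<close>)
  have "Suc h * elem_sym V c (Suc h) = (\<Sum>B\<in>?S (Suc h). \<Sum>u\<in>B. prod c B)"
    unfolding elem_sym_def sum_distrib_left by (rule sum.cong) auto
  also have "\<dots> = (\<Sum>(B, u)\<in>(SIGMA B:?S (Suc h). B). prod c B)"
    using finS fin by (subst sum.Sigma) (auto dest: finite_subset)
  also have "\<dots> = (\<Sum>(A, u)\<in>(SIGMA A:?S h. V - A). prod c (insert u A))"
    using sum.reindex_bij_betw[OF bij, of "\<lambda>(B, u). prod c B"] by (simp add: case_prod_unfold)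
  also have "\<dots> = (\<Sum>A\<in>?S h. \<Sum>u\<in>V - A. prod c (insert u A))"
    using finS fin by (subst sum.Sigma) auto
  also have "\<dots> = (\<Sum>A\<in>?S h. sum c (V - A) * prod c A)"
    unfolding sum_distrib_right
    by (intro sum.cong refl) (use fin in \<open>auto dest: finite_subset\<close>)
  also have "\<dots> \<le> (\<Sum>A\<in>?S h. (sum c V - 2 * h) * prod c A)"
  proof (rule sum_mono)
    fix A assume A: "A \<in> ?S h"
    then have finA: "finite A" using fin by (auto dest: finite_subset)
    show "sum c (V - A) * prod c A \<le> (sum c V - 2 * h) * prod c A"
    proof (cases "prod c A = 0")
      case False
      have "2 \<le> c a" if "a \<in> A" for a
      proof -
        have "c a \<noteq> 0" using False that finA by auto
        moreover have "c a \<noteq> 1" using free that A by (auto simp: one_free_def)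
        ultimately show ?thesis by simp
      qed
      then have "2 * h \<le> sum c A"
        using sum_bounded_below[of A 2 c] A by (simp add: mult.commute)
      moreover have "sum c V = sum c (V - A) + sum c A"
        by (rule sum.subset_diff) (use A fin in auto)
      ultimately have "sum c (V - A) \<le> sum c V - 2 * h" by linarith
      then show ?thesis by (rule mult_right_mono) simp
    qed simp
  qed
  also have "\<dots> = (sum c V - 2 * h) * elem_sym V c h" by (simp add: elem_sym_def sum_distrib_left)
  finally show ?thesis .
qed

text \<open>Given that the first \<open>h\<close> draws are distinct, at least \<open>h\<close> of the \<open>n - h\<close> remaining copies
  repeat a vertex drawn before, so that draw \<open>h + 1\<close> is new with probability at most
  \<open>1 - h / n\<close>.\<close>

lemma card_high_trees_step:
  fixes n :: nat
  assumes V: "finite V" "z \<in> V" "c z = 0" "card V = Suc n" "sum c V = n"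
    and free: "one_free V c" and h: "h \<le> n"
  shows "real (card (high_trees V c z (Suc h))) \<le> (1 - real h / n) * card (high_trees V c z h)"
proof -
  let ?N = "\<lambda>h. card (high_trees V c z h)"
  let ?F = "\<Prod>v\<in>V. fact (c v) :: nat"
  have F: "0 < ?F" by (simp add: prod_pos)
  have formula: "?N k * ?F = fact (n - k) * fact k * elem_sym V c k" for k
    using card_high_trees[OF V(1,2), of c, OF V(3), of k] V(4,5) by simp
  show ?thesis
  proof (cases "h < n")
    case False
    then have "elem_sym V c (Suc h) = 0" using elem_sym_eq_0[OF V(1,2), of c, OF V(3)] V(4) by simp
    then have "?N (Suc h) = 0" using formula[of "Suc h"] F by simp
    then show ?thesis using False h by simp
  next
    case True
    have "(n - h) * ?N (Suc h) * ?F = (n - h) * fact (n - Suc h) * fact h * (Suc h * elem_sym V c (Suc h))"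
      using formula[of "Suc h"] by (simp add: algebra_simps)
    also have "\<dots> \<le> (n - h) * fact (n - Suc h) * fact h * ((n - 2 * h) * elem_sym V c h)"
      using elem_sym_step_one_free[OF V(1) free, of h] V(5) by (intro mult_left_mono) auto
    also have "\<dots> = (n - 2 * h) * (fact (n - h) * fact h * elem_sym V c h)"
      using True by (simp add: fact_reduce[of "n - h"] mult_ac)
    also have "\<dots> = (n - 2 * h) * ?N h * ?F" using formula[of h] by simp
    finally have "(n - h) * ?N (Suc h) \<le> (n - 2 * h) * ?N h" using F by simp
    then have "real (n - h) * real (?N (Suc h)) \<le> real (n - 2 * h) * real (?N h)"
      by (metis of_nat_le_iff of_nat_mult)
    also have "real (n - 2 * h) \<le> (1 - real h / n) * real (n - h)"
    proof (cases "2 * h \<le> n")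
      case True
      have "(1 - real h / n) * real (n - h) = real n - 2 * h + (real h)\<^sup>2 / n"
        using \<open>h < n\<close> by (simp add: of_nat_diff field_simps power2_eq_square)
      then show ?thesis using True by (simp add: of_nat_diff)
    next
      case False
      then show ?thesis using \<open>h < n\<close> by simp
    qed
    finally have "real (n - h) * real (?N (Suc h)) \<le> real (n - h) * ((1 - real h / n) * real (?N h))"
      by (simp add: mult_right_mono mult_ac)
    then show ?thesis using True by simp
  qed
qed


section \<open>Tails of a weighted sequence with decreasing survival counts\<close>

definition composition_count :: "nat \<Rightarrow> nat \<Rightarrow> real" where
  "composition_count m s = real ((s + m - 1) choose s)"

lemma card_weak_compositions: "real (card (weak_compositions m h)) = composition_count m h"
  unfolding weak_compositions_def composition_count_def by (simp add: card_length_sum_list)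

lemma composition_count_nonneg: "0 \<le> composition_count m s"
  by (simp add: composition_count_def)

lemma composition_count_Suc:
  assumes "m \<ge> 1"
  shows "real (Suc s) * composition_count m (Suc s) = real (s + m) * composition_count m s"
proof -
  obtain k where k: "m = Suc k" using assms by (cases m) auto
  have "Suc s * (Suc (s + k) choose Suc s) = Suc (s + k) * ((s + k) choose s)"
    by (rule Suc_times_binomial)
  then show ?thesis unfolding composition_count_def k by (metis add_Suc_right add_Suc diff_Suc_1 of_nat_mult)
qed

lemma composition_count_mono:
  assumes "m \<ge> 1" and "s \<le> t"
  shows "composition_count m s \<le> composition_count m t"
  using assms(2)
proof (induction t rule: dec_induct)
  case base
  show ?case by simp
next
  case (step t)
  have "real (Suc t) * composition_count m t \<le> real (t + m) * composition_count m t"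
    using assms(1) composition_count_nonneg by (intro mult_right_mono) auto
  then have "composition_count m t \<le> composition_count m (Suc t)"
    unfolding composition_count_Suc[OF assms(1), symmetric] by simp
  then show ?case using step by simp
qed

lemma composition_count_growth:
  fixes m n s :: nat
  assumes m: "m \<ge> 1" and n: "n \<ge> 1" and s: "4 * m * n \<le> s\<^sup>2"
  shows "composition_count m (Suc s) \<le> (1 + real s / n / 4) * composition_count m s"
proof -
  have s0: "s > 0" using s m n by (cases s) auto
  have "4 * real m * real n \<le> (real s)\<^sup>2" using s by (metis of_nat_le_iff of_nat_mult of_nat_numeral of_nat_power)
  then have "real m \<le> real s * (real s / n / 4)" using n by (simp add: field_simps power2_eq_square)
  also have "\<dots> \<le> real (Suc s) * (real s / n / 4)" by (rule mult_right_mono) auto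
  finally have "real (s + m) \<le> real (Suc s) * (1 + real s / n / 4)" by (simp add: algebra_simps)
  then have "real (Suc s) * composition_count m (Suc s) \<le> real (Suc s) * (1 + real s / n / 4) * composition_count m s"
    unfolding composition_count_Suc[OF m] using composition_count_nonneg by (rule mult_right_mono)
  then show ?thesis by (simp add: mult.assoc)
qed

text \<open>Beyond \<open>2 * sqrt (m * n)\<close> the decay of \<open>G\<close> beats the growth of the weights by a
  constant factor in the exponent: with \<open>y = s / n\<close>, one step multiplies \<open>G\<close> by at most \<open>1 - y\<close> and
  the weight by at most \<open>1 + y / 4\<close>.  The bound propagates downwards in \<open>s\<close> because \<open>C = 4 / 3\<close>
  satisfies \<open>(1 - y) * (C * (1 + y / 4) - 1) \<le> C - 1\<close>, which amounts to \<open>(1 - y) * (1 + y) \<le> 1\<close>.\<close>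

lemma weighted_tail_le:
  fixes G A :: "nat \<Rightarrow> real" and m n s :: nat
  assumes m: "m \<ge> 1" and n: "n \<ge> 1"
    and G: "\<And>s. 0 \<le> G s"
    and G_step: "\<And>s. s \<le> n \<Longrightarrow> G (Suc s) \<le> (1 - real s / n) * G s"
    and A_step: "\<And>s. A s = composition_count m s * (G s - G (Suc s)) + A (Suc s)"
    and A_0: "\<And>s. n < s \<Longrightarrow> A s = 0"
    and s: "4 * m * n \<le> s\<^sup>2"
  shows "A s \<le> 4 / 3 * (composition_count m s * G s)"
  using s
proof (induction "Suc n - s" arbitrary: s)
  case 0
  then show ?case using A_0[of s] G composition_count_nonneg by simp
next
  case (Suc d)
  then have sn: "s \<le> n" by simp
  let ?w = "composition_count m s" and ?y = "real s / n"
  have "4 * m * n \<le> (Suc s)\<^sup>2" using Suc.prems by (simp add: power2_eq_square)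
  then have IH: "A (Suc s) \<le> 4 / 3 * (composition_count m (Suc s) * G (Suc s))"
    using Suc.hyps by simp
  have w': "composition_count m (Suc s) * G (Suc s) \<le> (1 + ?y / 4) * ?w * G (Suc s)"
    by (intro mult_right_mono composition_count_growth m n Suc.prems G)
  have "(1 + ?y) * G (Suc s) \<le> (1 + ?y) * ((1 - ?y) * G s)"
    by (intro mult_left_mono G_step sn) auto
  also have "\<dots> = G s - ?y * ?y * G s"
  proof -
    have "(1 + a) * ((1 - a) * g) = g - a * a * g" for a g :: real by (simp add: algebra_simps)
    then show ?thesis .
  qed
  also have "\<dots> \<le> G s" using G[of s] by simp
  finally have "?w * ((1 + ?y) * G (Suc s)) \<le> ?w * G s"
    using composition_count_nonneg by (rule mult_left_mono)
  then have "?w * G (Suc s) + ?y * (?w * G (Suc s)) \<le> ?w * G s" by (simp add: algebra_simps)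
  moreover have "composition_count m (Suc s) * G (Suc s) \<le> ?w * G (Suc s) + ?y * (?w * G (Suc s)) / 4"
    using w' by (simp add: algebra_simps)
  moreover have "A s = ?w * G s - ?w * G (Suc s) + A (Suc s)"
    using A_step[of s] by (simp add: algebra_simps)
  ultimately show ?case using IH by argo
qed

text \<open>The step from \<open>s + k\<close> to \<open>s + k + 1\<close> gains the factor \<open>exp (- 3 * (s + k) / (4 * n))\<close>.
  As \<open>s + k \<ge> k + 1 / 2\<close>, these exponents telescope against \<open>3 * k^2 / (8 * n)\<close>.\<close>

lemma weighted_decay:
  fixes G :: "nat \<Rightarrow> real" and m n s k :: nat
  assumes m: "m \<ge> 1" and n: "n \<ge> 1"
    and G: "\<And>s. 0 \<le> G s"
    and G_step: "\<And>s. s \<le> n \<Longrightarrow> G (Suc s) \<le> (1 - real s / n) * G s"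
    and G_0: "\<And>s. n < s \<Longrightarrow> G s = 0"
    and s: "4 * m * n \<le> s\<^sup>2"
  shows "composition_count m (s + k) * G (s + k) \<le> exp (- (3 * (real k)\<^sup>2 / (8 * n))) * (composition_count m s * G s)"
proof (induction k)
  case 0
  then show ?case by simp
next
  case (Suc k)
  let ?r = "s + k" and ?y = "real (s + k) / n"
  have s1: "s \<ge> 1" using s m n by (cases s) auto
  show ?case
  proof (cases "?r \<le> n")
    case False
    then show ?thesis using G_0[of "Suc ?r"] G[of s] composition_count_nonneg by simp
  next
    case True
    have large: "4 * m * n \<le> ?r\<^sup>2" using s by (simp add: power2_eq_square algebra_simps)
    have y: "0 \<le> ?y" "?y \<le> 1" using True n by auto
    have "composition_count m (Suc ?r) * G (Suc ?r) \<le>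
        ((1 + ?y / 4) * composition_count m ?r) * ((1 - ?y) * G ?r)"
      by (intro mult_mono composition_count_growth G_step m n large True G mult_nonneg_nonneg composition_count_nonneg)
        (use y in auto)
    also have "\<dots> = ((1 + ?y / 4) * (1 - ?y)) * (composition_count m ?r * G ?r)" by (simp only: mult_ac)
    also have "\<dots> \<le> exp (- (3 * ?y / 4)) * (composition_count m ?r * G ?r)"
    proof (intro mult_right_mono mult_nonneg_nonneg composition_count_nonneg G)
      have "(1 + ?y / 4) * (1 - ?y) \<le> exp (?y / 4) * exp (- ?y)"
        using exp_ge_add_one_self[of "?y / 4"] exp_ge_add_one_self[of "- ?y"] y
        by (intro mult_mono) auto
      also have "\<dots> = exp (- (3 * ?y / 4))" unfolding exp_add[symmetric] by simp
      finally show "(1 + ?y / 4) * (1 - ?y) \<le> exp (- (3 * ?y / 4))" .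
    qed
    also have "\<dots> \<le> exp (- (3 * ?y / 4)) * (exp (- (3 * (real k)\<^sup>2 / (8 * n))) * (composition_count m s * G s))"
      by (intro mult_left_mono Suc.IH) auto
    also have "\<dots> = exp (- (3 * ?y / 4) - 3 * (real k)\<^sup>2 / (8 * n)) * (composition_count m s * G s)"
      by (simp add: exp_diff exp_minus field_simps)
    also have "\<dots> \<le> exp (- (3 * (real (Suc k))\<^sup>2 / (8 * n))) * (composition_count m s * G s)"
    proof (intro mult_right_mono mult_nonneg_nonneg composition_count_nonneg G)
      have "2 * real (s + k) \<ge> 2 * real k + 1" using s1 by simp
      then have "3 * (real (Suc k))\<^sup>2 \<le> 3 * (2 * real (s + k)) + 3 * (real k)\<^sup>2"
        by (simp add: power2_eq_square algebra_simps)
      then have "3 * (real (Suc k))\<^sup>2 / (8 * n) \<le> (3 * (2 * real (s + k)) + 3 * (real k)\<^sup>2) / (8 * n)"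
        by (rule divide_right_mono) simp
      then show "exp (- (3 * ?y / 4) - 3 * (real k)\<^sup>2 / (8 * n)) \<le> exp (- (3 * (real (Suc k))\<^sup>2 / (8 * n)))"
        by (simp add: add_divide_distrib)
    qed
    finally show ?thesis by simp
  qed
qed

section \<open>The uniform pair of a tree and a composition\<close>

text \<open>Every vertex other than the root is a child of some vertex.\<close>

lemma sum_children_ge:
  assumes T: "T \<in> trees_with V c"
  shows "card V - 1 \<le> sum c V"
proof -
  have rt: "rooted_tree V T" and c: "\<And>v. v \<in> V \<Longrightarrow> card (child_set T v) = c v"
    using T by (auto simp: trees_with_def)
  have "V - {fst T} \<subseteq> (\<Union>u\<in>V. child_set T u)"
    using ht_parent[OF rt] by (fastforce simp: child_set_def)
  then have "card (V - {fst T}) \<le> card (\<Union>u\<in>V. child_set T u)"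
    using rooted_tree_finite[OF rt] child_set_subset[OF rt] by (intro card_mono) (auto intro: finite_subset)
  also have "\<dots> \<le> (\<Sum>u\<in>V. card (child_set T u))"
    by (rule card_UN_le[OF rooted_tree_finite[OF rt]])
  finally show ?thesis using c rooted_tree_root[OF rt] rooted_tree_finite[OF rt] by simp
qed

lemma high_trees_anti: "s \<le> t \<Longrightarrow> high_trees V c z t \<subseteq> high_trees V c z s"
  by (auto simp: high_trees_def)

lemma finite_high_trees: "finite (high_trees V c z h)"
  by (simp add: high_trees_def finite_trees_with)

lemma sum_high_trees_step:
  fixes w :: "nat \<Rightarrow> real"
  shows "(\<Sum>T\<in>high_trees V c z s. w (ht T z)) =
    w s * (real (card (high_trees V c z s)) - card (high_trees V c z (Suc s))) +
    (\<Sum>T\<in>high_trees V c z (Suc s). w (ht T z))"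
proof -
  let ?H = "high_trees V c z"
  have sub: "?H (Suc s) \<subseteq> ?H s" by (rule high_trees_anti) simp
  have eq: "ht T z = s" if "T \<in> ?H s - ?H (Suc s)" for T
    using that by (auto simp: high_trees_def)
  have "(\<Sum>T\<in>?H s. w (ht T z)) =
      (\<Sum>T\<in>?H s - ?H (Suc s). w (ht T z)) + (\<Sum>T\<in>?H (Suc s). w (ht T z))"
    by (rule sum.subset_diff[OF sub finite_high_trees])
  also have "(\<Sum>T\<in>?H s - ?H (Suc s). w (ht T z)) = w s * card (?H s - ?H (Suc s))"
    using eq by simp
  also have "real (card (?H s - ?H (Suc s))) = real (card (?H s)) - card (?H (Suc s))"
    using card_Diff_subset[OF finite_high_trees sub] card_mono[OF finite_high_trees sub]
    by (simp add: of_nat_diff)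
  finally show ?thesis .
qed

lemma card_tree_pairs_high:
  "real (card (tree_pairs V c m z \<inter> {(T, P). h \<le> ht T z})) =
    (\<Sum>T\<in>high_trees V c z h. composition_count m (ht T z))"
proof -
  have eq: "tree_pairs V c m z \<inter> {(T, P). h \<le> ht T z} =
      (SIGMA T:high_trees V c z h. weak_compositions m (ht T z))"
    by (auto simp: tree_pairs_def high_trees_def)
  have fin: "finite (weak_compositions m (ht T z))" if "T \<in> high_trees V c z h" for T
  proof -
    have "Pair T ` weak_compositions m (ht T z) \<subseteq> tree_pairs V c m z"
      using that by (auto simp: tree_pairs_def high_trees_def)
    then have "finite (Pair T ` weak_compositions m (ht T z))"
      using finite_tree_pairs by (rule finite_subset)
    then show ?thesis by (rule finite_imageD) (simp add: inj_on_def)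
  qed
  show ?thesis
    unfolding eq using fin finite_high_trees[of V c z h]
    by (subst card_SigmaI) (auto simp: card_weak_compositions)
qed

theorem theorem1p9:
  fixes m n :: nat and c :: "nat \<Rightarrow> nat" and x :: real
  assumes "m \<ge> 1" and "n \<ge> 1" and "n \<ge> 64 * m"
    and "child_sequence {0..n} c" and "one_free {0..n} c"
    and "c 0 = 0" and "trees_with {0..n} c \<noteq> {}"
    and "x \<ge> 0"
  shows "measure_pmf.prob (pmf_of_set (tree_pairs {0..n} c m 0))
           {(T, P). real (ht T 0) \<ge> 2 * sqrt (real m * real n) + x * sqrt (real n)}
         \<le> exp (- (x\<^sup>2 / 3) + 4)"
    (is "?prob \<le> _")
proof (cases "x \<le> 1")
  case True
  have "x\<^sup>2 \<le> 1" using True assms(8) by (simp add: power_le_one)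
  then have "1 \<le> exp (- (x\<^sup>2 / 3) + 4)" by simp
  moreover have "?prob \<le> 1" by (rule measure_pmf.prob_le_1)
  ultimately show ?thesis by linarith
next
  case False
  define q where "q = 2 * sqrt (real m * real n)"
  define s where "s = nat \<lceil>q\<rceil>"
  define t where "t = nat \<lceil>q + x * sqrt n\<rceil>"
  define G where "G = (\<lambda>h. real (card (high_trees {0..n} c 0 h)))"
  define A where "A = (\<lambda>h. \<Sum>T\<in>high_trees {0..n} c 0 h. composition_count m (ht T 0))"
  have sumc: "sum c {0..n} = n"
  proof -
    obtain T where "T \<in> trees_with {0..n} c" using assms(7) by blast
    then have "n \<le> sum c {0..n}" using sum_children_ge by fastforce
    then show ?thesis using assms(4) by (simp add: child_sequence_def flip: of_nat_sum)
  qed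
  have G_nonneg: "0 \<le> G h" for h by (simp add: G_def)
  have G_step: "G (Suc h) \<le> (1 - real h / n) * G h" if "h \<le> n" for h
    unfolding G_def
    by (rule card_high_trees_step) (use assms sumc that in auto)
  have empty: "high_trees {0..n} c 0 h = {}" if "n < h" for h
  proof -
    have "elem_sym {0..n} c h = 0" by (rule elem_sym_eq_0) (use assms that in auto)
    then have "card (high_trees {0..n} c 0 h) * (\<Prod>v\<in>{0..n}. fact (c v)) = 0"
      using card_high_trees[of "{0..n}" 0 c h] assms sumc by simp
    then show ?thesis using finite_high_trees[of "{0..n}" c 0 h] by simp
  qed
  have A_step: "A h = composition_count m h * (G h - G (Suc h)) + A (Suc h)" for h
    unfolding A_def G_def by (rule sum_high_trees_step)
  have q: "0 \<le> q" "q\<^sup>2 = 4 * real m * real n" by (auto simp: q_def power_mult_distrib)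
  have xn: "0 \<le> x * sqrt n" using assms(8) by simp
  have s_ge: "q \<le> real s" and s_less: "real s < q + 1" using q by (auto simp: s_def) linarith+
  have t_ge: "q + x * sqrt n \<le> real t" using q xn by (auto simp: t_def)
  have "4 * real m * real n \<le> (real s)\<^sup>2"
    using power_mono[OF s_ge q(1), of 2] q(2) by simp
  then have s_large: "4 * m * n \<le> s\<^sup>2"
    by (metis of_nat_le_iff of_nat_mult of_nat_numeral of_nat_power)
  have st: "s \<le> t" unfolding s_def t_def using xn by (intro nat_mono ceiling_mono) simp
  then have "s\<^sup>2 \<le> t\<^sup>2" by (rule power_mono) simp
  with s_large have t_large: "4 * m * n \<le> t\<^sup>2" by (rule order_trans)
  define k where "k = t - s"
  have k: "t = s + k" using st by (simp add: k_def)
  have k_ge: "x * sqrt n - 1 \<le> real k" using t_ge s_less k by simp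
  have A_0: "A h = 0" if "n < h" for h using empty[OF that] by (simp add: A_def)
  have G_0: "G h = 0" if "n < h" for h using empty[OF that] by (simp add: G_def)
  have "A t \<le> 4 / 3 * (composition_count m t * G t)"
    by (rule weighted_tail_le[OF assms(1,2) G_nonneg G_step A_step A_0 t_large])
  also have "composition_count m t * G t \<le> exp (- (3 * (real k)\<^sup>2 / (8 * n))) * (composition_count m s * G s)"
    unfolding k by (rule weighted_decay[OF assms(1,2) G_nonneg G_step G_0 s_large])
  also have "composition_count m s * G s \<le> A 0"
  proof -
    have "composition_count m s * G s = (\<Sum>T\<in>high_trees {0..n} c 0 s. composition_count m s)" by (simp add: G_def)
    also have "\<dots> \<le> A s"
      unfolding A_def by (intro sum_mono composition_count_mono assms(1)) (simp add: high_trees_def)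
    also have "\<dots> \<le> A 0"
      unfolding A_def
      by (intro sum_mono2 finite_high_trees high_trees_anti composition_count_nonneg) simp
    finally show ?thesis .
  qed
  finally have tail: "A t \<le> 4 / 3 * (exp (- (3 * (real k)\<^sup>2 / (8 * n))) * A 0)"
    by (simp add: mult_left_mono)
  have const: "4 / 3 * exp (- (3 * (real k)\<^sup>2 / (8 * n))) \<le> exp (- (x\<^sup>2 / 3) + 4)"
  proof -
    \<comment> \<open>Rounding both thresholds up costs at most one level, that is \<open>b\<close> on the scale of \<open>x\<close>.\<close>
    define b where "b = 1 / sqrt n"
    have "8 \<le> sqrt n" by (rule real_le_rsqrt) (use assms(1,3) in simp)
    then have b: "0 < b" "b \<le> 1 / 8" and xb: "x * sqrt n - 1 = (x - b) * sqrt n"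
      using assms(2) divide_left_mono[of 8 "sqrt n" 1] by (auto simp: b_def left_diff_distrib)
    have "0 \<le> (x - b) * sqrt n" using False b by simp
    then have "((x - b) * sqrt n)\<^sup>2 \<le> (real k)\<^sup>2" using k_ge xb by (intro power_mono) auto
    then have "(x - b)\<^sup>2 * n \<le> (real k)\<^sup>2" by (simp add: power_mult_distrib)
    then have "3 / 8 * (x - b)\<^sup>2 \<le> 3 * (real k)\<^sup>2 / (8 * n)"
      using assms(2) by (simp add: pos_le_divide_eq mult_ac)
    moreover have "x\<^sup>2 / 3 - 3 \<le> 3 / 8 * (x - b)\<^sup>2"
    proof -
      have "b * x \<le> 1 / 8 * x" using b assms(8) by (intro mult_right_mono) auto
      moreover have "0 \<le> x\<^sup>2 - 9 / 4 * x + 81 / 64"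
        using zero_le_power2[of "x - 9 / 8"] by (simp add: power2_eq_square algebra_simps)
      moreover have "3 / 8 * (x - b)\<^sup>2 = 3 / 8 * x\<^sup>2 - 3 / 4 * (b * x) + 3 / 8 * b\<^sup>2"
        by (simp add: power2_eq_square algebra_simps)
      moreover have "0 \<le> b\<^sup>2" by simp
      ultimately show ?thesis by linarith
    qed
    ultimately have "1 - 3 * (real k)\<^sup>2 / (8 * n) \<le> - (x\<^sup>2 / 3) + 4" by simp
    then have "exp 1 * exp (- (3 * (real k)\<^sup>2 / (8 * n))) \<le> exp (- (x\<^sup>2 / 3) + 4)"
      unfolding exp_add[symmetric] by simp
    moreover have "4 / 3 \<le> exp (1::real)" using exp_ge_add_one_self[of 1] by simp
    ultimately show ?thesis by (meson exp_ge_zero mult_right_mono order_trans)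
  qed
  have ne: "tree_pairs {0..n} c m 0 \<noteq> {}" by (rule tree_pairs_nonempty[OF assms(7,1)])
  have event: "{(T, P). real (ht T 0) \<ge> 2 * sqrt (real m * real n) + x * sqrt (real n)} =
      {(T :: nat rtree, P :: nat list). t \<le> ht T 0}"
    unfolding t_def q_def by (auto simp: nat_le_iff ceiling_le_iff)
  have A0: "real (card (tree_pairs {0..n} c m 0)) = A 0"
    using card_tree_pairs_high[of "{0..n}" c m 0 0] by (simp add: A_def)
  then have A0_pos: "0 < A 0" using ne finite_tree_pairs[of "{0..n}" c m 0] by (metis card_gt_0_iff of_nat_0_less_iff)
  have "?prob = A t / A 0"
    unfolding event measure_pmf_of_set[OF ne finite_tree_pairs] A0 card_tree_pairs_high A_def ..
  also have "\<dots> \<le> 4 / 3 * exp (- (3 * (real k)\<^sup>2 / (8 * n)))"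
    using tail A0_pos by (simp add: pos_divide_le_eq)
  also note const
  finally show ?thesis .
qed

end
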